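(* Let $(X,*,\to,e)$ be an algebra with binary operations $*,\to$ and constant $e$ satisfying, for all $x,y$: $x\to x=e$, $e\to x=x$, and $((x\to y)\to y)*(((x\to y)\to y)\to x)=x$ (a Johnstone algebra). Define $x\le y$ iff $x\to y=e$. \begin{enumerate} \item If $X$ satisfies Residuation $x\to(y\to z)=(y*x)\to z$, then $\le$ is a partial order on $X$ and $(X,*,e)$ is a monoid. Moreover, an algebra $(X,*,\to,e)$ satisfying the left loop axioms satisfies Residuation if and only if $(X,*,e)$ is a group. \item If $X$ satisfies Compositionality $(x\to y)\to((z\to x)\to(z\to y))=e$, then $\le$ is a partial order on $X$ and $\to$ is increasing in its second argument ($y\le z$ implies $(x\to y)\le(x\to z)$). Moreover, an algebra $(X,*,\to,e)$ satisfying the left loop axioms satisfies Compositionality if and only if $(X,*,e)$ is a group. \item If $X$ satisfies both Residuation and Compositionality, then for each $x\in X$ and all $y,z\in X$: $x*y\le z$ iff $y\le x\to z$; consequently $*$ is increasing in its right argument. \item If $X$ satisfies $x*y=y*x$, Residuation and Compositionality, then $X$ satisfies $x\to(y\to z)=y\to(x\to z)$ and $x\to((x\to y)\to y)=e$; moreover $*$ is increasing in both arguments, and $\to$ is decreasing in its first argument and increasing in its second argument (with respect to $\le$). \end{enumerate}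
   Context: An algebra $(X,*,\to,e)$ satisfies the left loop axioms if for all $x,y$: $x*(x\to y)=y$, $x\to(x*y)=y$, $x*e=x$ and $e*x=x$. (Such algebras satisfy the Johnstone algebra axioms.) *)

theory Defs
  imports "HOL-Algebra.Group"
begin

text \<open>An algebra \<open>(X, *, \<rightarrow>, e)\<close> is a HOL-Algebra \<open>monoid\<close> record (\<open>carrier\<close>, \<open>\<otimes>\<close>, \<open>\<one>\<close>) extended
  by a field for \<open>\<rightarrow>\<close>, written \<open>\<leadsto>\<close> because \<open>\<rightarrow>\<close> is taken by function sets. The record itself
  imposes no laws; the library predicates \<open>monoid\<close> and \<open>group\<close> apply to it and see only the
  reduct \<open>(X, *, e)\<close>.\<close>

record 'a imp_algebra = "'a monoid" +
  imp :: "'a \<Rightarrow> 'a \<Rightarrow> 'a"  (infixr \<open>\<leadsto>\<index>\<close> 65)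

locale imp_magma =
  fixes A :: "('a, 'b) imp_algebra_scheme" (structure)
  assumes mult_closed: "\<lbrakk>x \<in> carrier A; y \<in> carrier A\<rbrakk> \<Longrightarrow> x \<otimes> y \<in> carrier A"
    and imp_closed: "\<lbrakk>x \<in> carrier A; y \<in> carrier A\<rbrakk> \<Longrightarrow> (x \<leadsto> y) \<in> carrier A"
    and unit_closed: "\<one> \<in> carrier A"

locale johnstone_algebra = imp_magma +
  assumes imp_self: "x \<in> carrier A \<Longrightarrow> (x \<leadsto> x) = \<one>"
    and unit_imp: "x \<in> carrier A \<Longrightarrow> (\<one> \<leadsto> x) = x"
    and johnstone: "\<lbrakk>x \<in> carrier A; y \<in> carrier A\<rbrakk> \<Longrightarrow>
      ((x \<leadsto> y) \<leadsto> y) \<otimes> (((x \<leadsto> y) \<leadsto> y) \<leadsto> x) = x"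

locale left_loop_algebra = imp_magma +
  assumes mult_imp: "\<lbrakk>x \<in> carrier A; y \<in> carrier A\<rbrakk> \<Longrightarrow> x \<otimes> (x \<leadsto> y) = y"
    and imp_mult: "\<lbrakk>x \<in> carrier A; y \<in> carrier A\<rbrakk> \<Longrightarrow> (x \<leadsto> (x \<otimes> y)) = y"
    and mult_unit: "x \<in> carrier A \<Longrightarrow> x \<otimes> \<one> = x"
    and unit_mult: "x \<in> carrier A \<Longrightarrow> \<one> \<otimes> x = x"

definition residuation :: "('a, 'b) imp_algebra_scheme \<Rightarrow> bool" where
  "residuation A \<longleftrightarrow> (\<forall>x\<in>carrier A. \<forall>y\<in>carrier A. \<forall>z\<in>carrier A.
     (x \<leadsto>\<^bsub>A\<^esub> (y \<leadsto>\<^bsub>A\<^esub> z)) = ((y \<otimes>\<^bsub>A\<^esub> x) \<leadsto>\<^bsub>A\<^esub> z))"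

definition compositionality :: "('a, 'b) imp_algebra_scheme \<Rightarrow> bool" where
  "compositionality A \<longleftrightarrow> (\<forall>x\<in>carrier A. \<forall>y\<in>carrier A. \<forall>z\<in>carrier A.
     ((x \<leadsto>\<^bsub>A\<^esub> y) \<leadsto>\<^bsub>A\<^esub> ((z \<leadsto>\<^bsub>A\<^esub> x) \<leadsto>\<^bsub>A\<^esub> (z \<leadsto>\<^bsub>A\<^esub> y))) = \<one>\<^bsub>A\<^esub>)"

definition imp_le :: "('a, 'b) imp_algebra_scheme \<Rightarrow> 'a \<Rightarrow> 'a \<Rightarrow> bool"  (infix \<open>\<preceq>\<index>\<close> 50) where
  "x \<preceq>\<^bsub>A\<^esub> y \<longleftrightarrow> (x \<leadsto>\<^bsub>A\<^esub> y) = \<one>\<^bsub>A\<^esub>"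

definition imp_le_rel :: "('a, 'b) imp_algebra_scheme \<Rightarrow> 'a rel" where
  "imp_le_rel A = {(x, y). x \<in> carrier A \<and> y \<in> carrier A \<and> x \<preceq>\<^bsub>A\<^esub> y}"

definition increasing_on :: "('a, 'b) imp_algebra_scheme \<Rightarrow> ('a \<Rightarrow> 'a) \<Rightarrow> bool" where
  "increasing_on A f \<longleftrightarrow> monotone_on (carrier A) (imp_le A) (imp_le A) f"

definition decreasing_on :: "('a, 'b) imp_algebra_scheme \<Rightarrow> ('a \<Rightarrow> 'a) \<Rightarrow> bool" where
  "decreasing_on A f \<longleftrightarrow> monotone_on (carrier A) (imp_le A) (\<lambda>x y. y \<preceq>\<^bsub>A\<^esub> x) f"

end

theory Submission
  imports Defs
begin

text \<open>In any Johnstone algebra \<open>x \<preceq> y\<close> gives \<open>y \<otimes> (y \<leadsto> x) = x\<close>, and this yields antisymmetry.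
  Under Residuation, \<open>\<otimes>\<close> is associative because \<open>(x \<otimes> y) \<otimes> z\<close> and \<open>x \<otimes> (y \<otimes> z)\<close> have the same
  implications \<open>_ \<leadsto> w\<close>, which separate points. In a left loop algebra \<open>\<preceq>\<close> is equality, so
  Compositionality is an identity which unfolds to associativity of \<open>\<otimes>\<close>.\<close>

lemma residuationD:
  assumes "residuation A" "x \<in> carrier A" "y \<in> carrier A" "z \<in> carrier A"
  shows "(x \<leadsto>\<^bsub>A\<^esub> (y \<leadsto>\<^bsub>A\<^esub> z)) = ((y \<otimes>\<^bsub>A\<^esub> x) \<leadsto>\<^bsub>A\<^esub> z)"
  using assms unfolding residuation_def by blast

lemma compositionalityD:
  assumes "compositionality A" "x \<in> carrier A" "y \<in> carrier A" "z \<in> carrier A"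
  shows "((x \<leadsto>\<^bsub>A\<^esub> y) \<leadsto>\<^bsub>A\<^esub> ((z \<leadsto>\<^bsub>A\<^esub> x) \<leadsto>\<^bsub>A\<^esub> (z \<leadsto>\<^bsub>A\<^esub> y))) = \<one>\<^bsub>A\<^esub>"
  using assms unfolding compositionality_def by blast

section \<open>Johnstone algebras and their order\<close>

context johnstone_algebra
begin

text \<open>For equal arguments \<open>(x \<leadsto> x) \<leadsto> x\<close> is
  \<open>\<one> \<leadsto> x\<close>, that is \<open>x\<close>, so the Johnstone identity becomes
  \<open>x \<otimes> (x \<leadsto> x) = x\<close>.\<close>

lemma mult_unit_right:
  assumes "x \<in> carrier A"
  shows "x \<otimes> \<one> = x"
  using johnstone[OF assms assms] assms by (simp add: imp_self unit_imp)

lemma imp_le_refl: "x \<in> carrier A \<Longrightarrow> x \<preceq> x"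
  by (simp add: imp_le_def imp_self)

text \<open>When \<open>x \<leadsto> y\<close> is the unit,
  \<open>(x \<leadsto> y) \<leadsto> y\<close> collapses to \<open>y\<close> in the Johnstone
  identity.\<close>

lemma mult_imp_of_le:
  assumes "x \<in> carrier A" "y \<in> carrier A" "x \<preceq> y"
  shows "y \<otimes> (y \<leadsto> x) = x"
  using johnstone[OF assms(1,2)] assms by (simp add: imp_le_def unit_imp)

lemma imp_le_antisym:
  assumes "x \<in> carrier A" "y \<in> carrier A" "x \<preceq> y" "y \<preceq> x"
  shows "x = y"
  using mult_imp_of_le[OF assms(1-3)] assms by (simp add: imp_le_def mult_unit_right)

text \<open>Taking \<open>w = x\<close> and \<open>w = y\<close> gives both inequalities, so
  antisymmetry applies. This serves for equations between products, since Residuation turns an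
  implication out of a product into nested implications.\<close>

lemma eq_if_imp_eq:
  assumes "x \<in> carrier A" "y \<in> carrier A"
    and "\<And>w. w \<in> carrier A \<Longrightarrow> (x \<leadsto> w) = (y \<leadsto> w)"
  shows "x = y"
  using imp_le_antisym[OF assms(1,2)] assms(3)[OF assms(1)] assms(3)[OF assms(2)]
    imp_self[OF assms(1)] imp_self[OF assms(2)]
  unfolding imp_le_def by metis

text \<open>Transitivity is left as a hypothesis because Residuation and Compositionality supply it
  by different arguments.\<close>

lemma partial_order_on_imp_le_rel:
  assumes "\<And>x y z. \<lbrakk>x \<in> carrier A; y \<in> carrier A; z \<in> carrier A; x \<preceq> y; y \<preceq> z\<rbrakk> \<Longrightarrow> x \<preceq> z"
  shows "partial_order_on (carrier A) (imp_le_rel A)"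
  unfolding partial_order_on_def preorder_on_def
proof (intro conjI)
  show "refl_on (carrier A) (imp_le_rel A)"
    using imp_le_refl by (simp add: refl_on_def imp_le_rel_def)
  show "trans (imp_le_rel A)"
    unfolding imp_le_rel_def trans_def using assms by blast
  show "antisym (imp_le_rel A)"
    unfolding imp_le_rel_def antisym_def using imp_le_antisym by blast
  show "imp_le_rel A \<subseteq> carrier A \<times> carrier A"
    by (auto simp: imp_le_rel_def)
qed

lemma imp_le_trans_if_residuation:
  assumes res: "residuation A"
    and c: "x \<in> carrier A" "y \<in> carrier A" "z \<in> carrier A"
    and xy: "x \<preceq> y" and yz: "y \<preceq> z"
  shows "x \<preceq> z"
proof -
  note x = mult_imp_of_le[OF c(1,2) xy]
  \<comment> \<open>Residuation is applied to the factorization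
    \<open>x = y \<otimes> (y \<leadsto> x)\<close>.\<close>
  have res_y: "((y \<leadsto> x) \<leadsto> (y \<leadsto> w)) = (x \<leadsto> w)" if "w \<in> carrier A" for w
    using residuationD[OF res imp_closed[OF c(2,1)] c(2) that] by (simp add: x)
  \<comment> \<open>For \<open>w = z\<close> and for \<open>w = y\<close> alike,
    \<open>y \<leadsto> w\<close> is the unit, so \<open>x \<leadsto> z\<close> and
    \<open>x \<leadsto> y\<close> have the same value.\<close>
  have "(x \<leadsto> z) = ((y \<leadsto> x) \<leadsto> \<one>)"
    using res_y[OF c(3)] yz by (simp add: imp_le_def)
  also have "\<dots> = (x \<leadsto> y)"
    using res_y[OF c(2)] c by (simp add: imp_self)
  finally show ?thesis
    using xy by (simp add: imp_le_def)
qed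

lemma monoid_if_residuation:
  assumes res: "residuation A"
  shows "monoid A"
proof
  fix x y z
  assume c: "x \<in> carrier A" "y \<in> carrier A" "z \<in> carrier A"
  \<comment> \<open>Into any \<open>w\<close>, both products have the implication
    \<open>z \<leadsto> (y \<leadsto> (x \<leadsto> w))\<close>.\<close>
  show "x \<otimes> y \<otimes> z = x \<otimes> (y \<otimes> z)"
    by (rule eq_if_imp_eq)
      (simp_all add: c mult_closed imp_closed residuationD[OF res, symmetric])
next
  fix x
  assume c: "x \<in> carrier A"
  \<comment> \<open>Here \<open>(\<one> \<otimes> x) \<leadsto> w\<close> unfolds to
    \<open>x \<leadsto> (\<one> \<leadsto> w)\<close>.\<close>
  show "\<one> \<otimes> x = x"
    by (rule eq_if_imp_eq)
      (simp_all add: c mult_closed unit_closed unit_imp residuationD[OF res, symmetric])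
qed (simp_all add: mult_closed unit_closed mult_unit_right)

text \<open>In \<open>(y \<leadsto> z) \<leadsto> ((x \<leadsto> y) \<leadsto> (x \<leadsto> z)) =
  \<one>\<close> the outer premise is the unit and drops out.\<close>

lemma imp_mono_right:
  assumes "compositionality A" "x \<in> carrier A" "y \<in> carrier A" "z \<in> carrier A" "y \<preceq> z"
  shows "(x \<leadsto> y) \<preceq> (x \<leadsto> z)"
  using compositionalityD[OF assms(1,3,4,2)] assms by (simp add: imp_le_def unit_imp imp_closed)

text \<open>The same instance of Compositionality as in \<open>imp_mono_right\<close>, but now the
  inner premise \<open>x \<leadsto> y\<close> is the unit.\<close>

lemma imp_antimono_left:
  assumes "compositionality A" "x \<in> carrier A" "y \<in> carrier A" "z \<in> carrier A" "x \<preceq> y"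
  shows "(y \<leadsto> z) \<preceq> (x \<leadsto> z)"
  using compositionalityD[OF assms(1,3,4,2)] assms by (simp add: imp_le_def unit_imp imp_closed)

text \<open>Applying \<open>x \<leadsto> _\<close> to \<open>y \<preceq> z\<close> gives
  \<open>\<one> \<preceq> (x \<leadsto> z)\<close>, and only the unit itself lies above the
  unit.\<close>

lemma imp_le_trans_if_compositionality:
  assumes "compositionality A" "x \<in> carrier A" "y \<in> carrier A" "z \<in> carrier A"
    and "x \<preceq> y" "y \<preceq> z"
  shows "x \<preceq> z"
  using imp_mono_right[OF assms(1-4,6)] assms by (simp add: imp_le_def unit_imp imp_closed)

lemma mult_le_iff_le_imp:
  assumes "residuation A" "x \<in> carrier A" "y \<in> carrier A" "z \<in> carrier A"
  shows "x \<otimes> y \<preceq> z \<longleftrightarrow> y \<preceq> (x \<leadsto> z)"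
  using residuationD[OF assms(1,3,2,4)] by (simp add: imp_le_def)

text \<open>The usual adjunction argument: the unit inequality
  \<open>z \<preceq> (x \<leadsto> (x \<otimes> z))\<close> is extended down to \<open>y\<close> by
  transitivity and transposed back.\<close>

lemma mult_mono_right:
  assumes "residuation A" and c: "x \<in> carrier A" "y \<in> carrier A" "z \<in> carrier A" and "y \<preceq> z"
  shows "x \<otimes> y \<preceq> x \<otimes> z"
proof -
  note xz = mult_closed[OF c(1,3)]
  have "z \<preceq> (x \<leadsto> (x \<otimes> z))"
    using mult_le_iff_le_imp[OF assms(1) c(1,3) xz] imp_le_refl[OF xz] by simp
  then have "y \<preceq> (x \<leadsto> (x \<otimes> z))"
    using imp_le_trans_if_residuation[OF assms(1) c(2,3) imp_closed[OF c(1) xz]] assms(5) by simp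
  then show ?thesis
    using mult_le_iff_le_imp[OF assms(1) c(1,2) xz] by simp
qed

lemma imp_exchange:
  assumes "residuation A" "x \<in> carrier A" "y \<in> carrier A" "z \<in> carrier A"
    and "x \<otimes> y = y \<otimes> x"
  shows "(x \<leadsto> (y \<leadsto> z)) = (y \<leadsto> (x \<leadsto> z))"
  using residuationD[OF assms(1-4)] residuationD[OF assms(1,3,2,4)] assms(5) by metis

end

section \<open>Left loop algebras and groups\<close>

context left_loop_algebra
begin

lemma imp_self_eq_unit: "x \<in> carrier A \<Longrightarrow> (x \<leadsto> x) = \<one>"
  using imp_mult[of x \<one>] by (simp add: mult_unit unit_closed)

text \<open>The Johnstone identity is an instance of \<open>mult_imp\<close>. This makes the results
  on Residuation available for left loops.\<close>

lemma johnstone_algebra: "johnstone_algebra A"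
proof
  show "(\<one> \<leadsto> x) = x" if "x \<in> carrier A" for x
    using imp_mult[OF unit_closed that] that by (simp add: unit_mult)
qed (simp_all add: imp_self_eq_unit mult_imp imp_closed)

lemma imp_eq_unit_iff:
  assumes "x \<in> carrier A" "y \<in> carrier A"
  shows "(x \<leadsto> y) = \<one> \<longleftrightarrow> x = y"
  using mult_imp[OF assms] assms by (auto simp: imp_self_eq_unit mult_unit)

lemma group_if_monoid:
  assumes "monoid A"
  shows "group A"
proof -
  interpret monoid A by fact
  show ?thesis
  proof (rule group_l_invI)
    fix x
    assume c: "x \<in> carrier A"
    let ?r = "x \<leadsto> \<one>"
    let ?s = "?r \<leadsto> \<one>"
    have r: "?r \<in> carrier A" and s: "?s \<in> carrier A"
      using c by (simp_all add: imp_closed)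
    \<comment> \<open>By \<open>mult_imp\<close>, \<open>?r\<close> is a right inverse of
      \<open>x\<close> and \<open>?s\<close> one of \<open>?r\<close>. So \<open>?r\<close> has left
      inverse \<open>x\<close> and right inverse \<open>?s\<close>, which coincide in a
      monoid.\<close>
    have "x = ?s"
      using inv_unique[OF mult_imp[OF c one_closed] mult_imp[OF r one_closed] r c s] .
    then have "?r \<otimes> x = \<one>"
      using mult_imp[OF r one_closed] by metis
    with r show "\<exists>y\<in>carrier A. y \<otimes> x = \<one>"
      by blast
  qed
qed

text \<open>By \<open>mult_imp\<close>, \<open>x \<leadsto> y\<close> solves
  \<open>x \<otimes> u = y\<close>, whose solution in a group is unique.\<close>

lemma imp_eq_inv_mult:
  assumes "group A" "x \<in> carrier A" "y \<in> carrier A"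
  shows "(x \<leadsto> y) = inv x \<otimes> y"
proof -
  interpret group A by fact
  show ?thesis
    using inv_solve_left[of "x \<leadsto> y" x y] assms by (simp add: imp_closed mult_imp)
qed

lemma residuation_iff_group: "residuation A \<longleftrightarrow> group A"
proof
  assume "residuation A"
  then show "group A"
    by (intro group_if_monoid johnstone_algebra.monoid_if_residuation johnstone_algebra)
next
  assume g: "group A"
  then interpret group A .
  show "residuation A"
    by (simp add: residuation_def imp_eq_inv_mult[OF g] inv_mult_group m_assoc)
qed

lemma monoid_if_compositionality:
  assumes comp: "compositionality A"
  shows "monoid A"
proof
  fix x y z
  assume c: "x \<in> carrier A" "y \<in> carrier A" "z \<in> carrier A"
  note xy = mult_closed[OF c(1,2)]
  note xyz = mult_closed[OF xy c(3)]
  note x_xyz = imp_closed[OF c(1) xyz]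
  \<comment> \<open>Compositionality at \<open>x \<otimes> y\<close>,
    \<open>x \<otimes> y \<otimes> z\<close> and \<open>x\<close>: by \<open>imp_mult\<close> the
    premises \<open>(x \<otimes> y) \<leadsto> (x \<otimes> y \<otimes> z)\<close> and
    \<open>x \<leadsto> (x \<otimes> y)\<close> become \<open>z\<close> and \<open>y\<close>. The
    remaining steps multiply by \<open>y\<close> and then by \<open>x\<close> to strip the
    implications.\<close>
  have "(z \<leadsto> (y \<leadsto> (x \<leadsto> (x \<otimes> y \<otimes> z)))) = \<one>"
    using compositionalityD[OF comp xy xyz c(1)] by (simp only: imp_mult c xy)
  then have "z = (y \<leadsto> (x \<leadsto> (x \<otimes> y \<otimes> z)))"
    by (simp only: imp_eq_unit_iff c x_xyz imp_closed)
  then have "y \<otimes> z = (x \<leadsto> (x \<otimes> y \<otimes> z))"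
    using mult_imp[OF c(2) x_xyz] by (simp only:)
  then show "x \<otimes> y \<otimes> z = x \<otimes> (y \<otimes> z)"
    using mult_imp[OF c(1) xyz] by (simp only:)
qed (simp_all add: mult_closed unit_closed mult_unit unit_mult)

lemma compositionality_iff_group: "compositionality A \<longleftrightarrow> group A"
proof
  assume "compositionality A"
  then show "group A"
    by (intro group_if_monoid monoid_if_compositionality)
next
  assume g: "group A"
  then interpret group A .
  \<comment> \<open>Left translation by \<open>inv z\<close> does not change
    \<open>inv x \<otimes> y\<close>, so Compositionality becomes
    \<open>inv u \<otimes> u = \<one>\<close> with \<open>u = inv x \<otimes> y\<close>.\<close>
  have "inv (inv z \<otimes> x) \<otimes> (inv z \<otimes> y) = inv x \<otimes> y"
    if "x \<in> carrier A" "y \<in> carrier A" "z \<in> carrier A" for x y z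
    using that by (simp add: inv_mult_group m_assoc) (simp add: m_assoc[symmetric])
  then show "compositionality A"
    by (simp add: compositionality_def imp_eq_inv_mult[OF g])
qed

end

theorem mainTheorem7:
  fixes A :: "('a, 'b) imp_algebra_scheme" (structure)
  shows
    "((johnstone_algebra A \<and> residuation A \<longrightarrow>
         partial_order_on (carrier A) (imp_le_rel A) \<and> monoid A) \<and>
      (left_loop_algebra A \<longrightarrow> (residuation A \<longleftrightarrow> group A)))
     \<and>
     ((johnstone_algebra A \<and> compositionality A \<longrightarrow>
         partial_order_on (carrier A) (imp_le_rel A) \<and>
         (\<forall>x\<in>carrier A. increasing_on A (\<lambda>y. x \<leadsto> y))) \<and>
      (left_loop_algebra A \<longrightarrow> (compositionality A \<longleftrightarrow> group A)))
     \<and>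
     (johnstone_algebra A \<and> residuation A \<and> compositionality A \<longrightarrow>
        (\<forall>x\<in>carrier A. \<forall>y\<in>carrier A. \<forall>z\<in>carrier A.
            x \<otimes> y \<preceq> z \<longleftrightarrow> y \<preceq> (x \<leadsto> z)) \<and>
        (\<forall>x\<in>carrier A. increasing_on A (\<lambda>y. x \<otimes> y)))
     \<and>
     (johnstone_algebra A \<and>
      (\<forall>x\<in>carrier A. \<forall>y\<in>carrier A. x \<otimes> y = y \<otimes> x) \<and>
      residuation A \<and> compositionality A \<longrightarrow>
        (\<forall>x\<in>carrier A. \<forall>y\<in>carrier A. \<forall>z\<in>carrier A.
            (x \<leadsto> (y \<leadsto> z)) = (y \<leadsto> (x \<leadsto> z))) \<and>
        (\<forall>x\<in>carrier A. \<forall>y\<in>carrier A. (x \<leadsto> ((x \<leadsto> y) \<leadsto> y)) = \<one>) \<and>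
        (\<forall>y\<in>carrier A. increasing_on A (\<lambda>x. x \<otimes> y)) \<and>
        (\<forall>x\<in>carrier A. increasing_on A (\<lambda>y. x \<otimes> y)) \<and>
        (\<forall>y\<in>carrier A. decreasing_on A (\<lambda>x. x \<leadsto> y)) \<and>
        (\<forall>x\<in>carrier A. increasing_on A (\<lambda>y. x \<leadsto> y)))"
proof (intro conjI impI; (elim conjE)?)
  assume "johnstone_algebra A" and res: "residuation A"
  then interpret johnstone_algebra A by simp
  show "partial_order_on (carrier A) (imp_le_rel A)"
    using partial_order_on_imp_le_rel imp_le_trans_if_residuation[OF res] by blast
  show "monoid A"
    using monoid_if_residuation[OF res] .
next
  assume "left_loop_algebra A"
  then show "residuation A \<longleftrightarrow> group A" "compositionality A \<longleftrightarrow> group A"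
    by (rule left_loop_algebra.residuation_iff_group left_loop_algebra.compositionality_iff_group)+
next
  assume "johnstone_algebra A" and comp: "compositionality A"
  then interpret johnstone_algebra A by simp
  show "partial_order_on (carrier A) (imp_le_rel A)"
    using partial_order_on_imp_le_rel imp_le_trans_if_compositionality[OF comp] by blast
  show "\<forall>x\<in>carrier A. increasing_on A (\<lambda>y. x \<leadsto> y)"
    using imp_mono_right[OF comp] by (auto simp: increasing_on_def monotone_on_def)
next
  assume "johnstone_algebra A" and res: "residuation A"
  then interpret johnstone_algebra A by simp
  show "\<forall>x\<in>carrier A. \<forall>y\<in>carrier A. \<forall>z\<in>carrier A. x \<otimes> y \<preceq> z \<longleftrightarrow> y \<preceq> (x \<leadsto> z)"
    using mult_le_iff_le_imp[OF res] by blast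
  show "\<forall>x\<in>carrier A. increasing_on A (\<lambda>y. x \<otimes> y)"
    using mult_mono_right[OF res] by (auto simp: increasing_on_def monotone_on_def)
next
  assume "johnstone_algebra A" and comm: "\<forall>x\<in>carrier A. \<forall>y\<in>carrier A. x \<otimes> y = y \<otimes> x"
    and res: "residuation A" and comp: "compositionality A"
  then interpret johnstone_algebra A by simp
  have exchange: "(x \<leadsto> (y \<leadsto> z)) = (y \<leadsto> (x \<leadsto> z))"
    if "x \<in> carrier A" "y \<in> carrier A" "z \<in> carrier A" for x y z
    using imp_exchange[OF res that] comm that by blast
  then show "\<forall>x\<in>carrier A. \<forall>y\<in>carrier A. \<forall>z\<in>carrier A. (x \<leadsto> (y \<leadsto> z)) = (y \<leadsto> (x \<leadsto> z))"
    by blast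
  \<comment> \<open>Exchange turns the term into
    \<open>(x \<leadsto> y) \<leadsto> (x \<leadsto> y)\<close>.\<close>
  show "\<forall>x\<in>carrier A. \<forall>y\<in>carrier A. (x \<leadsto> ((x \<leadsto> y) \<leadsto> y)) = \<one>"
    using exchange imp_self imp_closed by metis
  show "\<forall>x\<in>carrier A. increasing_on A (\<lambda>y. x \<otimes> y)"
    using mult_mono_right[OF res] by (auto simp: increasing_on_def monotone_on_def)
  then show "\<forall>y\<in>carrier A. increasing_on A (\<lambda>x. x \<otimes> y)"
    using comm by (simp add: increasing_on_def monotone_on_def)
  show "\<forall>y\<in>carrier A. decreasing_on A (\<lambda>x. x \<leadsto> y)"
    using imp_antimono_left[OF comp] by (auto simp: decreasing_on_def monotone_on_def)
  show "\<forall>x\<in>carrier A. increasing_on A (\<lambda>y. x \<leadsto> y)"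
    using imp_mono_right[OF comp] by (auto simp: increasing_on_def monotone_on_def)
qed

end
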